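(* Every directed Eulerian graph arises as the directed medial graph of a collection of hypermaps.
   Context: A directed graph (loops allowed) is Eulerian if the in-degree of each vertex is equal to its out-degree. "Arises as" is understood up to isomorphism of digraphs. A collection of hypermaps $(\sigma,\alpha)$ is an ordered pair of permutations acting on the same finite set of points, say $\{1,2,\ldots,n\}$. Its medial map $M(\sigma,\alpha)=(\sigma',\alpha')$ is the following pair of permutations of the set $\{1^-,1^+,2^-,2^+,\ldots,n^-,n^+\}$: the cycles of $\sigma'$ are all cycles of the form $(i_1^-,i_1^+,i_2^-,i_2^+,\ldots,i_k^-,i_k^+)$ where $(i_1,i_2,\ldots,i_k)$ is a cycle of $\alpha$ (fixed points being cycles of length $1$); the cycles of $\alpha'$ are all cycles of the form $(i^+,\sigma(i)^-)$. The directed medial graph of $(\sigma,\alpha)$ is the digraph whose vertices are the cycles of $\sigma'$ and whose edges are the cycles $(i^+,\sigma(i)^-)$ of $\alpha'$, each directed from its positive endpoint $i^+$ (tail, at the vertex containing $i^+$) toward its negative endpoint $\sigma(i)^-$ (head, at the vertex containing $\sigma(i)^-$).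
   Formalization: Graphs are finite and assumed to have no isolated vertices: a single vertex with no edges is Eulerian, but every vertex of a directed medial graph is the tail of an edge, so the claim fails for it. *)

theory Defs
  imports "HOL-Combinatorics.Orbits" "Graph_Theory.Graph_Theory"
begin

text \<open>
  A directed graph is a \<^locale>\<open>fin_digraph\<close>: finite, with loops and parallel arcs allowed.
\<close>

definition eulerian_digraph :: "('a, 'b) pre_digraph \<Rightarrow> bool" where
  "eulerian_digraph G \<longleftrightarrow> fin_digraph G \<and> (\<forall>v\<in>verts G. in_degree G v = out_degree G v)"

text \<open>
  Each cycle of a permutation \<open>p\<close> of \<open>S\<close>, fixed points included as cycles of length 1, is
  represented by the set of its points. (Representing it by the cyclic permutation of those
  points would identify all fixed points of \<open>p\<close>.)
\<close>

definition cycles_on :: "'a set \<Rightarrow> ('a \<Rightarrow> 'a) \<Rightarrow> 'a set set" where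
  "cycles_on S p = orbit p ` S"

definition hypermap_collection :: "nat \<Rightarrow> (nat \<Rightarrow> nat) \<Rightarrow> (nat \<Rightarrow> nat) \<Rightarrow> bool" where
  "hypermap_collection n \<sigma> \<alpha> \<longleftrightarrow> \<sigma> permutes {1..n} \<and> \<alpha> permutes {1..n}"

text \<open>\<open>Neg i\<close> and \<open>Pos i\<close> are the points written $i^-$ and $i^+$.\<close>

datatype signed_point = Neg nat | Pos nat

definition signed_points :: "nat \<Rightarrow> signed_point set" where
  "signed_points n = Neg ` {1..n} \<union> Pos ` {1..n}"

text \<open>
  The cycle $(i_1^-, i_1^+, \ldots, i_k^-, i_k^+)$ arising from the cycle $(i_1, \ldots, i_k)$
  of \<open>\<alpha>\<close> sends $i_j^-$ to $i_j^+$ and $i_j^+$ to $\alpha(i_j)^-$.  As required by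
  \<^const>\<open>permutes\<close>, both permutations fix everything outside \<open>signed_points n\<close>.
\<close>

fun medial_sigma :: "nat \<Rightarrow> (nat \<Rightarrow> nat) \<Rightarrow> signed_point \<Rightarrow> signed_point" where
  "medial_sigma n \<alpha> (Neg i) = (if i \<in> {1..n} then Pos i else Neg i)"
| "medial_sigma n \<alpha> (Pos i) = (if i \<in> {1..n} then Neg (\<alpha> i) else Pos i)"

fun medial_alpha :: "nat \<Rightarrow> (nat \<Rightarrow> nat) \<Rightarrow> signed_point \<Rightarrow> signed_point" where
  "medial_alpha n \<sigma> (Pos i) = (if i \<in> {1..n} then Neg (\<sigma> i) else Pos i)"
| "medial_alpha n \<sigma> (Neg i) = (if i \<in> {1..n} then Pos (inv \<sigma> i) else Neg i)"

definition medial_map ::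
  "nat \<Rightarrow> (nat \<Rightarrow> nat) \<times> (nat \<Rightarrow> nat) \<Rightarrow>
    (signed_point \<Rightarrow> signed_point) \<times> (signed_point \<Rightarrow> signed_point)" where
  "medial_map n = (\<lambda>(\<sigma>, \<alpha>). (medial_sigma n \<alpha>, medial_alpha n \<sigma>))"

text \<open>
  An arc is a two-element set \<open>e = {Pos i, Neg (\<sigma> i)}\<close>, so the descriptions below pick out its
  unique positive and its unique negative endpoint.
\<close>

definition directed_medial_graph ::
  "nat \<Rightarrow> (nat \<Rightarrow> nat) \<times> (nat \<Rightarrow> nat) \<Rightarrow> (signed_point set, signed_point set) pre_digraph" where
  "directed_medial_graph n h =
    (let (\<sigma>', \<alpha>') = medial_map n h in
     \<lparr> verts = cycles_on (signed_points n) \<sigma>',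
       arcs = cycles_on (signed_points n) \<alpha>',
       tail = (\<lambda>e. orbit \<sigma>' (Pos (THE i. Pos i \<in> e))),
       head = (\<lambda>e. orbit \<sigma>' (Neg (THE i. Neg i \<in> e))) \<rparr>)"

lemma medial_sigma_permutes:
  assumes "hypermap_collection n \<sigma> \<alpha>"
  shows "medial_sigma n \<alpha> permutes signed_points n"
proof (rule bij_imp_permutes)
  have a: "\<alpha> permutes {1..n}"
    using assms by (simp add: hypermap_collection_def)
  have inj: "inj_on (medial_sigma n \<alpha>) (signed_points n)"
    by (rule inj_onI) (auto simp: signed_points_def dest: injD[OF permutes_inj[OF a]])
  have "medial_sigma n \<alpha> ` signed_points n \<subseteq> signed_points n"
    using permutes_in_image[OF a] by (auto simp: signed_points_def)
  with inj show "bij_betw (medial_sigma n \<alpha>) (signed_points n) (signed_points n)"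
    by (simp add: bij_betw_def endo_inj_surj signed_points_def)
  show "medial_sigma n \<alpha> x = x" if "x \<notin> signed_points n" for x
    using that by (cases x) (auto simp: signed_points_def)
qed

lemma medial_alpha_permutes:
  assumes "hypermap_collection n \<sigma> \<alpha>"
  shows "medial_alpha n \<sigma> permutes signed_points n"
proof (rule bij_imp_permutes)
  have s: "\<sigma> permutes {1..n}"
    using assms by (simp add: hypermap_collection_def)
  have inj: "inj_on (medial_alpha n \<sigma>) (signed_points n)"
    by (rule inj_onI)
      (auto simp: signed_points_def dest: injD[OF permutes_inj[OF s]]
         injD[OF permutes_inj[OF permutes_inv[OF s]]])
  have "medial_alpha n \<sigma> ` signed_points n \<subseteq> signed_points n"
    using permutes_in_image[OF s] permutes_in_image[OF permutes_inv[OF s]]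
    by (auto simp: signed_points_def)
  with inj show "bij_betw (medial_alpha n \<sigma>) (signed_points n) (signed_points n)"
    by (simp add: bij_betw_def endo_inj_surj signed_points_def)
  show "medial_alpha n \<sigma> x = x" if "x \<notin> signed_points n" for x
    using that by (cases x) (auto simp: signed_points_def)
qed

lemma orbit_medial_alpha:
  assumes "hypermap_collection n \<sigma> \<alpha>" and "i \<in> {1..n}"
  shows "orbit (medial_alpha n \<sigma>) (Pos i) = {Pos i, Neg (\<sigma> i)}"
proof -
  have s: "\<sigma> permutes {1..n}"
    using assms by (simp add: hypermap_collection_def)
  have i: "\<sigma> i \<in> {1..n}" "inv \<sigma> (\<sigma> i) = i"
    using assms(2) permutes_in_image[OF s] permutes_inverses[OF s] by auto
  have "x \<in> {Pos i, Neg (\<sigma> i)}" if "x \<in> orbit (medial_alpha n \<sigma>) (Pos i)" for x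
    using that by induction (use assms(2) i in auto)
  moreover have "Neg (\<sigma> i) \<in> orbit (medial_alpha n \<sigma>) (Pos i)"
    using orbit.base[of "medial_alpha n \<sigma>" "Pos i"] assms(2) by simp
  moreover from orbit.step[OF this] have "Pos i \<in> orbit (medial_alpha n \<sigma>) (Pos i)"
    using i by simp
  ultimately show ?thesis by blast
qed

lemma orbit_medial_sigma:
  assumes "hypermap_collection n \<sigma> \<alpha>" and "i \<in> {1..n}"
  shows "orbit (medial_sigma n \<alpha>) (Neg i) = Neg ` orbit \<alpha> i \<union> Pos ` orbit \<alpha> i"
proof -
  have a: "\<alpha> permutes {1..n}"
    using assms by (simp add: hypermap_collection_def)
  have self: "i \<in> orbit \<alpha> i"
    using a by (intro permutation_self_in_orbit) (auto simp: permutation_permutes)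
  have sub: "j \<in> {1..n}" if "j \<in> orbit \<alpha> i" for j
    using that by induction (use assms(2) permutes_in_image[OF a] in auto)
  have "x \<in> Neg ` orbit \<alpha> i \<union> Pos ` orbit \<alpha> i"
    if "x \<in> orbit (medial_sigma n \<alpha>) (Neg i)" for x
    using that by induction (use assms(2) self in \<open>auto intro!: imageI intro: orbit.intros\<close>)
  moreover have Pi: "Pos i \<in> orbit (medial_sigma n \<alpha>) (Neg i)"
    using orbit.base[of "medial_sigma n \<alpha>" "Neg i"] assms(2) by simp
  moreover have "Neg j \<in> orbit (medial_sigma n \<alpha>) (Neg i) \<and> Pos j \<in> orbit (medial_sigma n \<alpha>) (Neg i)"
    if "j \<in> orbit \<alpha> i" for j
    using that
  proof induction
    case base
    have N: "Neg (\<alpha> i) \<in> orbit (medial_sigma n \<alpha>) (Neg i)"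
      using orbit.step[OF Pi] assms(2) by simp
    from orbit.step[OF N] N show ?case
      using sub[OF orbit.base] by simp
  next
    case (step j)
    then have P: "Pos j \<in> orbit (medial_sigma n \<alpha>) (Neg i)" by blast
    have N: "Neg (\<alpha> j) \<in> orbit (medial_sigma n \<alpha>) (Neg i)"
      using orbit.step[OF P] sub[OF step.hyps] by simp
    from orbit.step[OF N] N show ?case
      using sub[OF orbit.step[OF step.hyps]] by simp
  qed
  ultimately show ?thesis by blast
qed

text \<open>
  Every cycle of the first permutation contains some \<open>Pos i\<close>, so medial graphs never have isolated
  vertices: only Eulerian digraphs without isolated vertices can arise as medial graphs.
\<close>

lemma directed_medial_graph_no_isolated:
  assumes h: "hypermap_collection n \<sigma> \<alpha>"
    and v: "v \<in> verts (directed_medial_graph n (\<sigma>, \<alpha>))"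
  shows "out_arcs (directed_medial_graph n (\<sigma>, \<alpha>)) v \<noteq> {}"
proof -
  let ?G = "directed_medial_graph n (\<sigma>, \<alpha>)"
  have "permutation (medial_sigma n \<alpha>)"
    unfolding permutation_permutes
    by (intro exI conjI, rule_tac [2] medial_sigma_permutes[OF h]) (simp add: signed_points_def)
  note step = permutation_orbit_step[OF this]
  obtain x where x: "x \<in> signed_points n" "v = orbit (medial_sigma n \<alpha>) x"
    using v by (auto simp: directed_medial_graph_def medial_map_def cycles_on_def)
  obtain i where i: "i \<in> {1..n}" "v = orbit (medial_sigma n \<alpha>) (Pos i)"
  proof (cases x)
    case (Neg i)
    then have "i \<in> {1..n}" using x(1) by (auto simp: signed_points_def)
    with Neg x(2) step[of "Neg i"] show ?thesis by (intro that[of i]) simp_all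
  next
    case (Pos i)
    with x show ?thesis by (intro that[of i]) (auto simp: signed_points_def)
  qed
  let ?e = "orbit (medial_alpha n \<sigma>) (Pos i)"
  have "?e \<in> arcs ?G"
    using i(1)
    by (auto simp: directed_medial_graph_def medial_map_def cycles_on_def signed_points_def)
  moreover have "tail ?G ?e = v"
    using i by (simp add: directed_medial_graph_def medial_map_def orbit_medial_alpha[OF h i(1)])
  ultimately show ?thesis by (auto simp: out_arcs_def)
qed

end

(*
  Number the arcs of the digraph by 1, ..., n.  The medial graph of (sigma, alpha) has one arc for
  each i, from the cycle of alpha containing i to the cycle of alpha containing sigma i.  So let
  the cycles of alpha be the sets of arcs with a common tail, and let sigma match the arcs entering
  each vertex with the arcs leaving it, which is possible because both are equally many.
*)
theory Submission
  imports Defs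
begin

text \<open>List the points of \<open>A\<close> as \<open>e 0\<close>, ..., \<open>e (k - 1)\<close>
  and shift the index by one modulo \<open>k\<close>; this is a single cycle.\<close>

lemma ex_permutes_orbit_eq:
  fixes A :: "'a set"
  assumes fin: "finite A"
  shows "\<exists>p. p permutes A \<and> (\<forall>x\<in>A. orbit p x = A)"
proof (cases "A = {}")
  case True
  then show ?thesis by (intro exI[of _ id]) (auto simp: permutes_def)
next
  case False
  define k where "k = card A"
  have k: "0 < k"
    using fin False by (simp add: k_def card_gt_0_iff)
  obtain e where e: "bij_betw e {0..<k} A"
    using ex_bij_betw_nat_finite[OF fin] k_def by blast
  define d where "d = inv_into {0..<k} e"
  have d: "d (e i) = i" if "i < k" for i
    using e that by (simp add: d_def bij_betw_inv_into_left)
  have e_in: "e i \<in> A" if "i < k" for i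
    using e that by (auto simp: bij_betw_def)
  define p where "p x = (if x \<in> A then e (Suc (d x) mod k) else x)" for x
  have p_e: "p (e i) = e (Suc i mod k)" if "i < k" for i
    using that by (simp add: p_def d e_in)
  have pow: "(p ^^ m) (e 0) = e (m mod k)" for m
    by (induction m) (use k in \<open>simp_all add: p_e mod_Suc_eq\<close>)
  have "orbit p (e 0) = A"
  proof
    show "orbit p (e 0) \<subseteq> A"
      using k by (auto simp: orbit_altdef pow e_in)
    show "A \<subseteq> orbit p (e 0)"
    proof
      fix y assume "y \<in> A"
      then obtain i where i: "i < k" "y = e i"
        using e by (auto simp: bij_betw_def)
      \<comment> \<open>An orbit consists of the strictly positive iterates, so \<open>i + k\<close>
        serves as exponent: it is positive even for \<open>i = 0\<close>.\<close>
      then have "(p ^^ (i + k)) (e 0) = y"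
        by (simp only: pow) simp
      then show "y \<in> orbit p (e 0)"
        using k by (auto simp: orbit_altdef intro!: exI[of _ "i + k"])
    qed
  qed
  then have cyc: "cyclic_on p A"
    using e_in[OF k] by (auto simp: cyclic_on_def)
  have surj: "p ` A = A"
  proof
    show "p ` A \<subseteq> A"
      using k by (auto simp: p_def e_in)
    show "A \<subseteq> p ` A"
    proof
      fix y assume "y \<in> A"
      \<comment> \<open>Since \<open>y\<close> is a positive iterate of itself, its last step
        exhibits a preimage of \<open>y\<close>.\<close>
      then have "y \<in> orbit p y"
        using cyc by (simp add: cyclic_on_alldef)
      then show "y \<in> p ` A"
        by (cases rule: orbit.cases)
          (use \<open>y \<in> A\<close> cyc in \<open>auto simp: cyclic_on_alldef\<close>)
    qed
  qed
  then have "inj_on p A"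
    using fin by (simp add: finite_surj_inj)
  then have "p permutes A"
    using surj by (intro bij_imp_permutes) (auto simp: bij_betw_def p_def)
  then show ?thesis
    using cyc by (auto simp: cyclic_on_alldef)
qed

text \<open>The fibres of \<open>t\<close> partition \<open>S\<close>, so one cyclic permutation per
  fibre can be glued together. Each fibre is mapped to itself, which leaves the orbits unchanged.
  With \<open>t\<close> the tail of an arc this yields \<alpha>.\<close>

lemma ex_permutes_orbit_eq_fibre:
  assumes fin: "finite S"
  shows "\<exists>p. p permutes S \<and> (\<forall>x\<in>S. orbit p x = {y\<in>S. t y = t x})"
proof -
  define F where "F v = {y\<in>S. t y = v}" for v
  have "\<exists>p. p permutes F v \<and> (\<forall>x\<in>F v. orbit p x = F v)" for v
    using fin by (intro ex_permutes_orbit_eq) (simp add: F_def)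
  then obtain c where c: "\<And>v. c v permutes F v"
      and orb: "\<And>v x. x \<in> F v \<Longrightarrow> orbit (c v) x = F v"
    by metis
  define p where "p x = (if x \<in> S then c (t x) x else x)" for x
  have p_in: "p x \<in> F (t x)" if "x \<in> S" for x
    using that permutes_in_image[OF c[of "t x"], of x] by (simp add: p_def F_def)
  have orbit_p: "orbit p x = F (t x)" if "x \<in> S" for x
  proof -
    have x: "x \<in> F (t x)"
      using that by (simp add: F_def)
    have "orbit p x = orbit (c (t x)) x"
    proof (rule orbit_cong0[OF x, symmetric])
      show "c (t x) \<in> F (t x) \<rightarrow> F (t x)"
        using permutes_in_image[OF c] by auto
    qed (simp add: p_def F_def)
    then show ?thesis
      using orb[OF x] by simp
  qed
  have "inj_on p S"
  proof (rule inj_onI)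
    fix x y assume xy: "x \<in> S" "y \<in> S" "p x = p y"
    then have "t x = t y"
      using p_in[of x] p_in[of y] by (simp add: F_def)
    then show "x = y"
      using xy injD[OF permutes_inj[OF c[of "t x"]], of x y] by (simp add: p_def)
  qed
  then have "p permutes S"
    using p_in by (intro inj_imp_permutes[OF _ fin]) (auto simp: F_def p_def)
  then show ?thesis
    using orbit_p by (auto simp: F_def)
qed

text \<open>Bijections from the fibres of \<open>h\<close> to the equally large fibres of
  \<open>t\<close> are glued together. The result is injective across fibres because
  \<open>t (p x) = h x\<close> recovers the fibre of \<open>x\<close>. With \<open>h\<close> and
  \<open>t\<close> the head and tail of an arc this yields \<sigma>.\<close>

lemma ex_permutes_matching_fibres:
  assumes fin: "finite S"
    and eq: "\<And>v. card {x\<in>S. h x = v} = card {x\<in>S. t x = v}"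
  shows "\<exists>p. p permutes S \<and> (\<forall>x\<in>S. t (p x) = h x)"
proof -
  have "\<exists>g. bij_betw g {x\<in>S. h x = v} {x\<in>S. t x = v}" for v
    using fin eq by (intro finite_same_card_bij) auto
  then obtain g where g: "\<And>v. bij_betw (g v) {x\<in>S. h x = v} {x\<in>S. t x = v}"
    by metis
  define p where "p x = (if x \<in> S then g (h x) x else x)" for x
  have p_in: "p x \<in> S" "t (p x) = h x" if "x \<in> S" for x
    using that bij_betwE[OF g[of "h x"]] by (auto simp: p_def)
  have "inj_on p S"
  proof (rule inj_onI)
    fix x y assume xy: "x \<in> S" "y \<in> S" "p x = p y"
    then have "h x = h y"
      using p_in(2)[of x] p_in(2)[of y] by simp
    then show "x = y"
      using xy inj_onD[OF bij_betw_imp_inj_on[OF g[of "h x"]], of x y] by (simp add: p_def)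
  qed
  then have "p permutes S"
    by (rule inj_imp_permutes[OF _ fin]) (simp_all add: p_in, simp add: p_def)
  then show ?thesis
    using p_in by blast
qed

text \<open>\<open>Pos i\<close> is the image of \<open>Neg i\<close>, so both lie on the same
  cycle.\<close>

lemma orbit_medial_sigma_Pos:
  assumes "hypermap_collection n \<sigma> \<alpha>" and "i \<in> {1..n}"
  shows "orbit (medial_sigma n \<alpha>) (Pos i) = Neg ` orbit \<alpha> i \<union> Pos ` orbit \<alpha> i"
proof -
  have "permutation (medial_sigma n \<alpha>)"
    unfolding permutation_permutes
    by (intro exI conjI, rule_tac [2] medial_sigma_permutes[OF assms(1)]) (simp add: signed_points_def)
  from permutation_orbit_step[OF this, of "Neg i"] show ?thesis
    using assms by (simp add: orbit_medial_sigma)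
qed

lemma orbit_medial_alpha_Neg:
  assumes "hypermap_collection n \<sigma> \<alpha>" and "i \<in> {1..n}"
  shows "orbit (medial_alpha n \<sigma>) (Neg (\<sigma> i)) = {Pos i, Neg (\<sigma> i)}"
proof -
  have "permutation (medial_alpha n \<sigma>)"
    unfolding permutation_permutes
    by (intro exI conjI, rule_tac [2] medial_alpha_permutes[OF assms(1)]) (simp add: signed_points_def)
  from permutation_orbit_step[OF this, of "Pos i"] show ?thesis
    using assms by (simp add: orbit_medial_alpha)
qed

text \<open>Every arc contains exactly one positive point, so arcs can be indexed by
  \<open>i\<close> alone and their ends read off from the cycles of \<alpha>.\<close>

lemma directed_medial_graph_simps:
  assumes h: "hypermap_collection n \<sigma> \<alpha>"
  shows "verts (directed_medial_graph n (\<sigma>, \<alpha>)) =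
      (\<lambda>i. Neg ` orbit \<alpha> i \<union> Pos ` orbit \<alpha> i) ` {1..n}"
    and "arcs (directed_medial_graph n (\<sigma>, \<alpha>)) = (\<lambda>i. {Pos i, Neg (\<sigma> i)}) ` {1..n}"
    and "i \<in> {1..n} \<Longrightarrow> tail (directed_medial_graph n (\<sigma>, \<alpha>)) {Pos i, Neg (\<sigma> i)} =
      Neg ` orbit \<alpha> i \<union> Pos ` orbit \<alpha> i"
    and "i \<in> {1..n} \<Longrightarrow> head (directed_medial_graph n (\<sigma>, \<alpha>)) {Pos i, Neg (\<sigma> i)} =
      Neg ` orbit \<alpha> (\<sigma> i) \<union> Pos ` orbit \<alpha> (\<sigma> i)"
proof -
  have s: "\<sigma> permutes {1..n}"
    using h by (simp add: hypermap_collection_def)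
  \<comment> \<open>After this reindexing, the negative and the positive points produce the same
    family of cycles.\<close>
  have "Neg ` {1..n} = (\<lambda>i. Neg (\<sigma> i)) ` {1..n}"
    using permutes_image[OF s] by (metis image_image)
  then show "arcs (directed_medial_graph n (\<sigma>, \<alpha>)) = (\<lambda>i. {Pos i, Neg (\<sigma> i)}) ` {1..n}"
    using orbit_medial_alpha[OF h] orbit_medial_alpha_Neg[OF h]
    by (simp add: directed_medial_graph_def medial_map_def cycles_on_def signed_points_def
        image_Un image_image cong: image_cong_simp)
  show "verts (directed_medial_graph n (\<sigma>, \<alpha>)) =
      (\<lambda>i. Neg ` orbit \<alpha> i \<union> Pos ` orbit \<alpha> i) ` {1..n}"
    using orbit_medial_sigma[OF h] orbit_medial_sigma_Pos[OF h]
    by (simp add: directed_medial_graph_def medial_map_def cycles_on_def signed_points_def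
        image_Un image_image cong: image_cong_simp)
  assume i: "i \<in> {1..n}"
  then have "\<sigma> i \<in> {1..n}"
    using permutes_in_image[OF s] by blast
  then show "head (directed_medial_graph n (\<sigma>, \<alpha>)) {Pos i, Neg (\<sigma> i)} =
      Neg ` orbit \<alpha> (\<sigma> i) \<union> Pos ` orbit \<alpha> (\<sigma> i)"
    by (simp add: directed_medial_graph_def medial_map_def orbit_medial_sigma[OF h])
  show "tail (directed_medial_graph n (\<sigma>, \<alpha>)) {Pos i, Neg (\<sigma> i)} =
      Neg ` orbit \<alpha> i \<union> Pos ` orbit \<alpha> i"
    using i by (simp add: directed_medial_graph_def medial_map_def orbit_medial_sigma_Pos[OF h])
qed

theorem proposition3p3:
  fixes G :: "('a, 'b) pre_digraph"
  assumes "eulerian_digraph G"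
    and "\<And>v. v \<in> verts G \<Longrightarrow> in_arcs G v \<union> out_arcs G v \<noteq> {}"
  shows "\<exists>n \<sigma> \<alpha>. hypermap_collection n \<sigma> \<alpha> \<and>
           digraph_iso G (directed_medial_graph n (\<sigma>, \<alpha>))"
proof -
  interpret fin_digraph G
    using assms(1) by (simp add: eulerian_digraph_def)
  \<comment> \<open>The matching lemma compares fibres over all \<open>v\<close>; outside the vertex
    set both are empty.\<close>
  have deg: "card (in_arcs G v) = card (out_arcs G v)" for v
  proof (cases "v \<in> verts G")
    case True
    then show ?thesis
      using assms(1) by (simp add: eulerian_digraph_def in_degree_def out_degree_def)
  next
    case False
    then have "in_arcs G v = {}" "out_arcs G v = {}"
      by (auto simp: in_arcs_def out_arcs_def)
    then show ?thesis by simp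
  qed
  define n where "n = card (arcs G)"
  obtain f where f: "bij_betw f {1..n} (arcs G)"
    using ex_bij_betw_nat_finite_1[OF finite_arcs] n_def by blast
  define num where "num = inv_into {1..n} f"
  have num: "bij_betw num (arcs G) {1..n}"
    using f by (simp add: num_def bij_betw_inv_into)
  have num_f: "f (num a) = a" if "a \<in> arcs G" for a
    using f that by (simp add: num_def bij_betw_inv_into_right)
  have num_in: "num a \<in> {1..n}" if "a \<in> arcs G" for a
    using num that by (auto simp: bij_betw_def)
  define t where "t i = tail G (f i)" for i
  define h where "h i = head G (f i)" for i
  \<comment> \<open>Numbering the arcs preserves fibre sizes; \<open>u\<close> will be both
    \<open>head G\<close> and \<open>tail G\<close>.\<close>
  have fibre: "card {i\<in>{1..n}. u (f i) = v} = card {a\<in>arcs G. u a = v}"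
    for u :: "'b \<Rightarrow> 'a" and v
  proof -
    have "f ` {i\<in>{1..n}. u (f i) = v} = {a\<in>f ` {1..n}. u a = v}"
      by blast
    then have "bij_betw f {i\<in>{1..n}. u (f i) = v} {a\<in>arcs G. u a = v}"
      using f by (intro bij_betw_subset[OF f]) (auto simp only: bij_betw_def)
    then show ?thesis
      by (rule bij_betw_same_card)
  qed
  have "card {i\<in>{1..n}. h i = v} = card {i\<in>{1..n}. t i = v}" for v
    unfolding h_def t_def fibre using deg[of v] by (simp add: in_arcs_def out_arcs_def)
  then obtain \<sigma> where s: "\<sigma> permutes {1..n}" and ts: "\<And>i. i \<in> {1..n} \<Longrightarrow> t (\<sigma> i) = h i"
    using ex_permutes_matching_fibres[of "{1..n}" h t] by auto
  obtain \<alpha> where a: "\<alpha> permutes {1..n}"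
      and orb: "\<And>i. i \<in> {1..n} \<Longrightarrow> orbit \<alpha> i = {j\<in>{1..n}. t j = t i}"
    using ex_permutes_orbit_eq_fibre[of "{1..n}" t] by auto
  have hc: "hypermap_collection n \<sigma> \<alpha>"
    using s a by (simp add: hypermap_collection_def)
  define M where "M = directed_medial_graph n (\<sigma>, \<alpha>)"
  \<comment> \<open>The isomorphism: \<open>V v\<close> consists of the signed numbers of the arcs
    leaving \<open>v\<close>, and \<open>E a\<close> is the medial arc whose positive point carries
    the number of \<open>a\<close>.\<close>
  define V where "V v = Neg ` {j\<in>{1..n}. t j = v} \<union> Pos ` {j\<in>{1..n}. t j = v}" for v
  define E where "E a = {Pos (num a), Neg (\<sigma> (num a))}" for a
  note simps = directed_medial_graph_simps[OF hc, folded M_def]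
  have V_t: "Neg ` orbit \<alpha> i \<union> Pos ` orbit \<alpha> i = V (t i)" if "i \<in> {1..n}" for i
    using orb[OF that] by (simp add: V_def)
  have t_onto: "t ` {1..n} = verts G"
  proof
    show "t ` {1..n} \<subseteq> verts G"
      using bij_betwE[OF f] by (auto simp: t_def intro!: tail_in_verts)
    show "verts G \<subseteq> t ` {1..n}"
    proof
      fix v assume v: "v \<in> verts G"
      \<comment> \<open>Without outgoing arcs, the degree condition would rule out incoming ones
        too, making \<open>v\<close> isolated.\<close>
      have "out_arcs G v \<noteq> {}"
      proof
        assume "out_arcs G v = {}"
        then have "in_arcs G v = {}"
          using deg[of v] finite_in_arcs[of v] by simp
        with \<open>out_arcs G v = {}\<close> show False
          using assms(2)[OF v] by simp
      qed
      then obtain a where "a \<in> arcs G" "tail G a = v"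
        by (metis ex_in_conv in_out_arcs_conv)
      then have "t (num a) = v" "num a \<in> {1..n}"
        using num_in[of a] by (simp_all add: t_def num_f)
      then show "v \<in> t ` {1..n}"
        by blast
    qed
  qed
  have "verts M = (\<lambda>i. V (t i)) ` {1..n}"
    unfolding simps by (rule image_cong) (simp_all add: V_t)
  then have verts_M: "verts M = V ` verts G"
    using t_onto by (metis image_image)
  have arcs_M: "arcs M = E ` arcs G"
    using num by (auto simp: simps E_def bij_betw_def)
  \<comment> \<open>Every vertex is the tail of some arc, so \<open>V v\<close> is nonempty, and any
    point of it determines \<open>v\<close>.\<close>
  have inj_V: "inj_on V (verts G)"
  proof (rule inj_onI)
    fix v w assume "v \<in> verts G" and eq: "V v = V w"
    then obtain i where i: "i \<in> {1..n}" "t i = v"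
      using t_onto by (metis imageE)
    then have "Pos i \<in> V w"
      using eq by (auto simp: V_def)
    then show "v = w"
      using i by (auto simp: V_def)
  qed
  have "inj_on E (arcs G)"
    using num by (auto simp: E_def bij_betw_def inj_on_def doubleton_eq_iff)
  moreover have "V (tail G a) = tail M (E a)" "V (head G a) = head M (E a)" if "a \<in> arcs G" for a
  proof -
    have i: "num a \<in> {1..n}"
      using that by (rule num_in)
    have si: "\<sigma> (num a) \<in> {1..n}"
      using i permutes_in_image[OF s] by blast
    have "tail M (E a) = V (t (num a))"
      unfolding E_def simps(3)[OF i] by (rule V_t[OF i])
    then show "V (tail G a) = tail M (E a)"
      by (simp add: t_def num_f that)
    \<comment> \<open>By the choice of \<sigma>, the arc numbered \<open>\<sigma> (num a)\<close>
      leaves the vertex that \<open>a\<close> enters.\<close>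
    have "head M (E a) = V (t (\<sigma> (num a)))"
      unfolding E_def simps(4)[OF i] by (rule V_t[OF si])
    then show "V (head G a) = head M (E a)"
      by (simp add: ts[OF i] h_def num_f that)
  qed
  ultimately have "digraph_isomorphism
      \<lparr>iso_verts = V, iso_arcs = E, iso_head = head M, iso_tail = tail M\<rparr>"
    using inj_V wf_digraph_axioms by (simp add: digraph_isomorphism_def)
  \<comment> \<open>Equality of records also compares heads and tails on sets that are not arcs;
    taking \<open>head M\<close> and \<open>tail M\<close> themselves in the isomorphism makes them
    agree everywhere.\<close>
  moreover have "M = app_iso \<lparr>iso_verts = V, iso_arcs = E, iso_head = head M, iso_tail = tail M\<rparr> G"
    by (rule pre_digraph.equality) (simp_all add: verts_M arcs_M)
  ultimately have "digraph_iso G M"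
    unfolding digraph_iso_def by blast
  then show ?thesis
    using hc unfolding M_def by blast
qed

end
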